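(* For every integer $n \geq 2$, there exists a full-dimensional convex set $P \subseteq \mathbb{R}^n$ whose integer hull has depth \[ \operatorname{depth}_P(\operatorname{conv}(P \cap \mathbb{Z}^n)) = \frac{\sqrt{3+n}}{2}. \]
   Context: $\|\cdot\|$ is the Euclidean norm on $\mathbb{R}^n$, and $B(x,r) := \{y \in \mathbb{R}^n : \|y-x\| \le r\}$ for $r \in \mathbb{R}_+$. For $P \subseteq \mathbb{R}^n$ and $x \in P$, $\operatorname{depth}_P(x) := \sup\{ r \in \mathbb{R}_+ : B(x,r) \cap \operatorname{aff}(P) \subseteq P\}$, where $\operatorname{aff}(P)$ is the affine hull of $P$. For $S \subseteq P$, $\operatorname{depth}_P(S) := \sup\{\operatorname{depth}_P(x) : x \in P \setminus S\}$. The integer hull of $P$ is $\operatorname{conv}(P \cap \mathbb{Z}^n)$. *)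

theory Defs
  imports "HOL-Analysis.Analysis"
begin

text \<open>
  Depths are suprema of sets of nonnegative reals, taken in \<open>[0, \<infinity>]\<close>: a supremum of an
  unbounded set is \<open>\<infinity>\<close> (for instance when \<open>P\<close> is an affine subspace), and the supremum of the
  empty set is \<open>0\<close>.
\<close>

definition point_depth :: "'a::euclidean_space set \<Rightarrow> 'a \<Rightarrow> ennreal" where
  "point_depth P x = (SUP r \<in> {r::real. 0 \<le> r \<and> cball x r \<inter> affine hull P \<subseteq> P}. ennreal r)"

definition set_depth :: "'a::euclidean_space set \<Rightarrow> 'a set \<Rightarrow> ennreal" where
  "set_depth P S = (SUP x \<in> P - S. point_depth P x)"

definition integer_points :: "(real ^ 'n) set" where
  "integer_points = {x. \<forall>i. x $ i \<in> \<int>}"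

definition integer_hull :: "(real ^ 'n) set \<Rightarrow> (real ^ 'n) set" where
  "integer_hull P = convex hull (P \<inter> integer_points)"

end

theory Submission
  imports Defs
begin

text \<open>
  Let \<open>c\<close> have one coordinate \<open>0\<close> and all others \<open>1/2\<close>, and let \<open>P\<close> be the open ball around \<open>c\<close>
  of radius \<open>R = \<surd>(n + 3) / 2\<close>. Integer points off the hyperplane \<open>x\<^sub>k = 0\<close> through \<open>c\<close> have squared
  distance at least \<open>(n - 1)/4 + 1 = R\<^sup>2\<close> from \<open>c\<close>, so the integer hull of \<open>P\<close> lies in this
  hyperplane. Points of \<open>P\<close> arbitrarily close to \<open>c\<close> therefore avoid the hull, and their depths
  tend to \<open>R\<close>.
\<close>

text \<open>As \<open>R > 0\<close>, the ball is open and nonempty, so its affine hull is the whole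
  space and the depth condition becomes \<open>cball x r \<subseteq> ball c R\<close>.\<close>

lemma point_depth_ball_le:
  fixes c x :: "'a::euclidean_space"
  assumes "R > 0"
  shows "point_depth (ball c R) x \<le> ennreal R"
  unfolding point_depth_def
proof (rule SUP_least)
  fix r assume "r \<in> {r. 0 \<le> r \<and> cball x r \<inter> affine hull (ball c R) \<subseteq> ball c R}"
  then have "0 \<le> r" "cball x r \<subseteq> ball c R"
    using assms by (auto simp: affine_hull_open)
  then have "r \<le> R"
    using zero_le_dist[of x c] by (auto simp: cball_subset_ball_iff simp del: zero_le_dist)
  then show "ennreal r \<le> ennreal R" by (rule ennreal_leI)
qed

lemma point_depth_ball_ge:
  fixes c x :: "'a::euclidean_space"
  assumes "0 \<le> r" "dist x c + r < R"
  shows "ennreal r \<le> point_depth (ball c R) x"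
  unfolding point_depth_def
proof (rule SUP_upper)
  have "cball x r \<subseteq> ball c R"
    using assms by (simp add: cball_subset_ball_iff)
  then show "r \<in> {r. 0 \<le> r \<and> cball x r \<inter> affine hull (ball c R) \<subseteq> ball c R}"
    using assms(1) by auto
qed

text \<open>The center may lie in \<open>S\<close>, so the supremum is approached along the ray from
  \<open>c\<close> in direction \<open>v\<close>.\<close>

lemma set_depth_ball_eq:
  fixes c v :: "'a::euclidean_space"
  assumes "R > 0" and v: "norm v = 1"
    and avoid: "\<And>e. e > 0 \<Longrightarrow> c + e *\<^sub>R v \<notin> S"
  shows "set_depth (ball c R) S = ennreal R"
proof (rule antisym)
  show "set_depth (ball c R) S \<le> ennreal R"
    unfolding set_depth_def by (intro SUP_least point_depth_ball_le assms)
  show "ennreal R \<le> set_depth (ball c R) S"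
  proof (rule ennreal_le_epsilon)
    fix e :: real assume "e > 0"
    \<comment> \<open>A point at distance \<open>d\<close> from \<open>c\<close> gets the depth
      bound \<open>R - 2 * d\<close>: one \<open>d\<close> pays for the displacement, the other for
      the strict inequality in \<open>point_depth_ball_ge\<close>. Halving keeps this loss within
      \<open>e\<close> and the radius nonnegative.\<close>
    define d where "d = min e R / 2"
    have d: "0 < d" "2 * d \<le> e" "2 * d \<le> R"
      using \<open>e > 0\<close> \<open>R > 0\<close> by (auto simp: d_def)
    let ?x = "c + d *\<^sub>R v"
    have dist: "dist ?x c = d"
      using v d by (simp add: dist_norm)
    then have "?x \<in> ball c R - S"
      using d avoid by (simp add: dist_commute)
    then have "point_depth (ball c R) ?x \<le> set_depth (ball c R) S"
      unfolding set_depth_def by (rule SUP_upper)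
    moreover have "ennreal (R - 2 * d) \<le> point_depth (ball c R) ?x"
      using d dist by (intro point_depth_ball_ge) auto
    ultimately have "ennreal (R - 2 * d) \<le> set_depth (ball c R) S"
      by (rule order_trans[rotated])
    moreover have "ennreal R = ennreal (R - 2 * d) + ennreal (2 * d)"
      using d by (simp flip: ennreal_plus)
    ultimately show "ennreal R \<le> set_depth (ball c R) S + ennreal e"
      using d by (simp add: add_mono ennreal_leI)
  qed
qed

lemma half_le_abs_Ints_diff:
  assumes "(a::real) \<in> \<int>"
  shows "1/2 \<le> \<bar>a - 1/2\<bar>"
proof -
  obtain m where "a = of_int m" using assms by (auto elim: Ints_cases)
  then show ?thesis by (cases "m \<le> 0") (auto simp: abs_if)
qed

lemma integer_point_dist_ge:
  fixes x c :: "real ^ 'n" and k :: 'n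
  assumes c: "c = (\<chi> i. if i = k then 0 else 1/2)"
    and x: "x \<in> integer_points" and "x $ k \<noteq> 0"
  shows "sqrt (3 + real CARD('n)) / 2 \<le> dist c x"
proof -
  have Ints: "x $ i \<in> \<int>" for i using x by (auto simp: integer_points_def)
  \<comment> \<open>A nonzero integer is at least 1 away from 0, and any integer at least 1/2 away
    from 1/2.\<close>
  have le: "(if i = k then 1 else 1/4) \<le> (x $ i - c $ i)\<^sup>2" for i
  proof (cases "i = k")
    case True
    then show ?thesis
      using Ints_nonzero_abs_ge1[OF Ints \<open>x $ k \<noteq> 0\<close>] power_mono[of 1 "\<bar>x $ k\<bar>" 2]
      by (simp add: c)
  next
    case False
    then show ?thesis
      using power_mono[OF half_le_abs_Ints_diff[OF Ints[of i]], of 2]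
      by (simp add: c power2_eq_square)
  qed
  have "(3 + real CARD('n)) / 4 = (\<Sum>i\<in>UNIV. if i = k then 1 else 1/4 :: real)"
    by (simp add: sum.remove[of UNIV k] card_Diff_singleton of_nat_diff field_simps)
  also have "\<dots> \<le> (\<Sum>i\<in>UNIV. (x $ i - c $ i)\<^sup>2)"
    by (rule sum_mono) (rule le)
  also have "\<dots> = (dist c x)\<^sup>2"
    by (simp add: dist_norm norm_vec_def L2_set_def sum_nonneg power2_commute[of "c $ _"])
  finally have "sqrt ((3 + real CARD('n)) / 4) \<le> dist c x"
    by (intro real_le_lsqrt) auto
  then show ?thesis by (simp add: real_sqrt_divide)
qed

theorem theorem2:
  assumes "CARD('n::finite) \<ge> 2"
  shows "\<exists>P :: (real ^ 'n) set. convex P \<and> aff_dim P = int CARD('n) \<and>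
    set_depth P (integer_hull P) = ennreal (sqrt (3 + real CARD('n)) / 2)"
proof -
  obtain k :: 'n where True by blast
  define R where "R = sqrt (3 + real CARD('n)) / 2"
  define c :: "real ^ 'n" where "c = (\<chi> i. if i = k then 0 else 1/2)"
  have "R > 0" by (simp add: R_def add_pos_nonneg)
  \<comment> \<open>Openness matters: \<open>axis k 1\<close> is at distance exactly
    \<open>R\<close> from \<open>c\<close>.\<close>
  have "ball c R \<inter> integer_points \<subseteq> {x. x $ k = 0}"
    using integer_point_dist_ge[OF c_def] by (fastforce simp: R_def)
  moreover have "convex {x :: real ^ 'n. x $ k = 0}"
    by (auto simp: convex_def)
  ultimately have hull: "integer_hull (ball c R) \<subseteq> {x. x $ k = 0}"
    unfolding integer_hull_def by (rule hull_minimal)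
  have "set_depth (ball c R) (integer_hull (ball c R)) = ennreal R"
  proof (rule set_depth_ball_eq[OF \<open>R > 0\<close>])
    show "norm (axis k 1 :: real ^ 'n) = 1" by simp
    \<comment> \<open>Coordinate \<open>k\<close> of this point is \<open>e\<close>, so it is off
      the hyperplane.\<close>
    show "c + e *\<^sub>R axis k 1 \<notin> integer_hull (ball c R)" if "e > 0" for e
      using hull that by (auto simp: c_def axis_def)
  qed
  moreover have "aff_dim (ball c R) = int CARD('n)"
    using \<open>R > 0\<close> by (simp add: aff_dim_open)
  ultimately show ?thesis
    unfolding R_def using convex_ball by blast
qed

end
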